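(* Let $r>0$. The perimeter $p(\mathcal{C}(r))$ of the circle $\mathcal{C}(r)$ of radius $r$ ($\widetilde{\mathbf{SL}_2\mathbf{R}}$ geodesic distance) lying in the base plane and centred at the origin of the projective model of $\widetilde{\mathbf{SL}_2\mathbf{R}}$ geometry is $$p(\mathcal{C}(r))=\int_{-\pi}^{\pi}\sqrt{\sinh^2(r)\bigl(\sinh^2(r)+\cosh^2(r)\bigr)}\,\mathrm{d}\theta=2\pi\sinh(r)\sqrt{\cosh(2r)}.$$
   Context: In hyperboloid coordinates $(r,\theta,\phi)$, related to projective coordinates by $x^0=\cosh r\cos\phi$, $x^1=\cosh r\sin\phi$, $x^2=\sinh r\cos(\theta-\phi)$, $x^3=\sinh r\sin(\theta-\phi)$ (with $\phi$ extended to $\mathbf{R}$ to pass to the universal cover), the Riemannian metric of $\widetilde{\mathbf{SL}_2\mathbf{R}}$ is $$(\mathrm{d}s)^2=(\mathrm{d}r)^2+\cosh^2 r\,\sinh^2 r\,(\mathrm{d}\theta)^2+\bigl[\mathrm{d}\phi+\sinh^2 r\,\mathrm{d}\theta\bigr]^2.$$ The origin is $E_0=(1;0;0;0)$. The base plane is the surface $\phi=0$. The circle $\mathcal{C}(r)$ in the base plane centred at the origin is the curve of points with coordinates $(r,\theta,0)$, $\theta\in(-\pi,\pi]$; its perimeter is its length with respect to the Riemannian metric $(\mathrm{d}s)^2=(\mathrm{d}r)^2+\cosh^2 r\,\sinh^2 r\,(\mathrm{d}\theta)^2+\bigl[\mathrm{d}\phi+\sinh^2 r\,\mathrm{d}\theta\bigr]^2$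 of $\widetilde{\mathbf{SL}_2\mathbf{R}}$. *)

theory Defs
  imports "HOL-Analysis.Analysis"
begin

text \<open>
  A point of the universal cover of SL(2,R) is a pair of
  \<^item> the representative \<open>(x0, x1, x2, x3)\<close> of its projective coordinates that lies on the
    hyperboloid \<open>- x0\<^sup>2 - x1\<^sup>2 + x2\<^sup>2 + x3\<^sup>2 = -1\<close>, and
  \<^item> the lifted fibre coordinate \<open>\<phi> \<in> \<real>\<close>, which tells apart the points over the same
    \<open>(x0, x1, x2, x3)\<close>.
\<close>

type_synonym point = "(real \<times> real \<times> real \<times> real) \<times> real"

text \<open>Coordinates, and tangent vectors in coordinates, are triples \<open>(r, \<theta>, \<phi>)\<close>.\<close>

type_synonym coords = "real \<times> real \<times> real"

definition point_of :: "coords \<Rightarrow> point" where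
  "point_of = (\<lambda>(r, \<theta>, \<phi>).
     ((cosh r * cos \<phi>, cosh r * sin \<phi>, sinh r * cos (\<theta> - \<phi>), sinh r * sin (\<theta> - \<phi>)), \<phi>))"

definition coord_domain :: "coords set" where
  "coord_domain = {(r, \<theta>, \<phi>). r \<ge> 0}"

definition SL2R_cover :: "point set" where
  "SL2R_cover = point_of ` coord_domain"

definition E0 :: point where
  "E0 = ((1, 0, 0, 0), 0)"

definition base_plane :: "point set" where
  "base_plane = {P \<in> SL2R_cover. snd P = 0}"

text \<open>The quadratic form \<open>(ds)\<^sup>2\<close> at given coordinates, applied to a tangent vector.\<close>

definition metric_form :: "coords \<Rightarrow> coords \<Rightarrow> real" where
  "metric_form = (\<lambda>(r, \<theta>, \<phi>) (dr, d\<theta>, d\<phi>).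
     dr\<^sup>2 + (cosh r)\<^sup>2 * (sinh r)\<^sup>2 * d\<theta>\<^sup>2 + (d\<phi> + (sinh r)\<^sup>2 * d\<theta>)\<^sup>2)"

definition curve_length :: "(real \<Rightarrow> coords) \<Rightarrow> real \<Rightarrow> real \<Rightarrow> real" where
  "curve_length c a b =
     integral {a..b} (\<lambda>t. sqrt (metric_form (c t) (vector_derivative c (at t))))"

text \<open>
  The Riemannian distance: the infimum of the lengths of curves joining two points. Curves are
  given in coordinates. Neither this nor the restriction to \<open>C\<^sup>1\<close> curves affects the infimum:
  corners can be removed by slowing down to velocity zero; a curve meeting the axis \<open>r = 0\<close>,
  where \<open>\<theta>\<close> is not determined by the point, can be replaced by curves of
  almost the same length that avoid the axis except possibly at the end points; and on the
  axis \<open>metric_form\<close> is \<open>dr\<^sup>2 + d\<phi>\<^sup>2\<close>, so that changing \<open>\<theta>\<close> there does not contribute to the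
  length. With \<open>C\<^sup>1\<close> curves the integral above always exists; the weaker library notion
  \<open>piecewise_C1_differentiable_on\<close> would admit curves of infinite length, for which it is 0.
\<close>

definition joining_curves :: "point \<Rightarrow> point \<Rightarrow> (real \<Rightarrow> coords) set" where
  "joining_curves P Q =
     {c. c C1_differentiable_on {0..1} \<and> c ` {0..1} \<subseteq> coord_domain \<and>
         point_of (c 0) = P \<and> point_of (c 1) = Q}"

definition geodesic_dist :: "point \<Rightarrow> point \<Rightarrow> real" where
  "geodesic_dist P Q = (INF c \<in> joining_curves P Q. curve_length c 0 1)"

definition circle_curve :: "real \<Rightarrow> real \<Rightarrow> coords" where
  "circle_curve r = (\<lambda>\<theta>. (r, \<theta>, 0))"

definition circle_pts :: "real \<Rightarrow> point set" where
  "circle_pts r = (\<lambda>\<theta>. point_of (circle_curve r \<theta>)) ` {-pi<..pi}"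

definition perimeter :: "real \<Rightarrow> real" where
  "perimeter r = curve_length (circle_curve r) (-pi) pi"

end

theory Submission
  imports Defs
begin

text \<open>
  The form \<open>(ds)\<^sup>2\<close> dominates \<open>(dr)\<^sup>2\<close>, so a curve from the origin to a point
  with radial coordinate \<open>s\<close> has length at least \<open>\<integral> dr = s\<close>, and in the base plane the radial
  segment attains this bound. The perimeter formula follows from
  \<open>cosh\<^sup>2 r sinh\<^sup>2 r + sinh\<^sup>4 r = sinh\<^sup>2 r (sinh\<^sup>2 r + cosh\<^sup>2 r) = sinh\<^sup>2 r cosh (2r)\<close>.
\<close>

lemma metric_form_fst_le: "fst v \<le> sqrt (metric_form p v)"
  by (rule real_le_rsqrt) (auto simp: metric_form_def split: prod.splits)

lemma continuous_on_sqrt_metric_form: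
  assumes "continuous_on S c" "continuous_on S D"
  shows "continuous_on S (\<lambda>t. sqrt (metric_form (c t) (D t)))"
  unfolding metric_form_def case_prod_unfold
  by (intro continuous_intros assms)

text \<open>With fibre coordinate 0 the first projective coordinate is the \<open>cosh\<close> of
  the radius, and \<open>cosh\<close> is injective on nonnegative reals. Only the radius is
  recovered: the angle is fixed at most modulo 2 pi, and not at all at radius 0.\<close>

lemma point_of_base_plane_radius:
  assumes "point_of p = point_of (s, \<theta>, 0)" "p \<in> coord_domain" "s \<ge> 0"
  shows "fst p = s"
proof -
  obtain a \<beta> \<phi> where p: "p = (a, \<beta>, \<phi>)"
    by (cases p)
  have "a \<ge> 0" "cosh a = cosh s"
    using assms by (auto simp: p point_of_def coord_domain_def)
  then show ?thesis
    using \<open>s \<ge> 0\<close> by (simp add: p cosh_real_nonneg_le_iff eq_iff)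
qed

text \<open>The free angle lets the radial segment in any direction start at the origin.\<close>

lemma E0_eq_point_of: "E0 = point_of (0, \<theta>, 0)"
  by (simp add: E0_def point_of_def)

lemma curve_length_ge_radius_diff:
  assumes "c C1_differentiable_on {a..b}" "a \<le> b"
  shows "fst (c b) - fst (c a) \<le> curve_length c a b"
proof -
  obtain D where D: "\<And>t. t \<in> {a..b} \<Longrightarrow> (c has_vector_derivative D t) (at t)"
    and contD: "continuous_on {a..b} D"
    using assms(1) unfolding C1_differentiable_on_def by blast
  have contc: "continuous_on {a..b} c"
    by (rule C1_differentiable_imp_continuous_on[OF assms(1)])
  have "((\<lambda>t. fst (c t)) has_vector_derivative fst (D t)) (at t within {a..b})"
    if "t \<in> {a..b}" for t
    using bounded_linear.has_vector_derivative[OF bounded_linear_fst D[OF that]]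
    by (rule has_vector_derivative_at_within)
  from fundamental_theorem_of_calculus[OF \<open>a \<le> b\<close> this]
  have "((\<lambda>t. fst (D t)) has_integral fst (c b) - fst (c a)) {a..b}"
    by simp
  moreover have "((\<lambda>t. sqrt (metric_form (c t) (D t))) has_integral
      integral {a..b} (\<lambda>t. sqrt (metric_form (c t) (D t)))) {a..b}"
    by (intro integrable_integral integrable_continuous_real continuous_on_sqrt_metric_form
        contc contD)
  ultimately have "fst (c b) - fst (c a) \<le> integral {a..b} (\<lambda>t. sqrt (metric_form (c t) (D t)))"
    by (rule has_integral_le) (rule metric_form_fst_le)
  \<comment> \<open>\<open>D\<close> is a two-sided derivative even at the end points, so it agrees
    with \<open>vector_derivative\<close> on the whole interval.\<close>
  also have "\<dots> = curve_length c a b"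
    unfolding curve_length_def
    by (rule integral_cong) (simp only: vector_derivative_at[OF D])
  finally show ?thesis .
qed

lemma radial_curve_has_vector_derivative:
  "((\<lambda>t. (t * s, \<theta>, 0) :: coords) has_vector_derivative (s, 0, 0)) (at t)"
  by (intro has_vector_derivative_Pair has_vector_derivative_const)
    (auto intro!: derivative_eq_intros simp: has_real_derivative_iff_has_vector_derivative[symmetric])

lemma geodesic_dist_base_plane:
  assumes "s \<ge> 0"
  shows "geodesic_dist E0 (point_of (s, \<theta>, 0)) = s"
  unfolding geodesic_dist_def
\<comment> \<open>The infimum is a minimum: \<open>s\<close> is itself the length of a joining curve
  and bounds all such lengths from below.\<close>
proof (rule cInf_eq_minimum)
  \<comment> \<open>The radial segment, run at constant speed \<open>s\<close>.\<close>
  let ?c = "\<lambda>t. (t * s, \<theta>, 0) :: coords"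
  have "?c C1_differentiable_on {0..1}"
    unfolding C1_differentiable_on_def
    by (rule exI[of _ "\<lambda>_. (s, 0, 0)"])
      (auto simp: radial_curve_has_vector_derivative)
  then have "?c \<in> joining_curves E0 (point_of (s, \<theta>, 0))"
    using assms
    by (auto simp: joining_curves_def coord_domain_def E0_eq_point_of[of \<theta>])
  moreover have "curve_length ?c 0 1 = s"
    using assms
    by (simp add: curve_length_def vector_derivative_at[OF radial_curve_has_vector_derivative]
        metric_form_def)
  ultimately show "s \<in> (\<lambda>c. curve_length c 0 1) ` joining_curves E0 (point_of (s, \<theta>, 0))"
    by (metis imageI)
next
  fix l
  assume "l \<in> (\<lambda>c. curve_length c 0 1) ` joining_curves E0 (point_of (s, \<theta>, 0))"
  then obtain c where c: "c \<in> joining_curves E0 (point_of (s, \<theta>, 0))"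
    and l: "l = curve_length c 0 1"
    by blast
  have "c 0 \<in> coord_domain" "c 1 \<in> coord_domain"
    using c by (auto simp: joining_curves_def)
  then have "fst (c 0) = 0" "fst (c 1) = s"
    using c assms
    by (auto simp: joining_curves_def E0_eq_point_of[of \<theta>] intro: point_of_base_plane_radius)
  then show "s \<le> l"
    using curve_length_ge_radius_diff[of c 0 1] c by (simp add: l joining_curves_def)
qed

lemma base_plane_eq: "base_plane = {point_of (s, \<theta>, 0) | s \<theta>. s \<ge> 0}"
  by (force simp: base_plane_def SL2R_cover_def coord_domain_def point_of_def)

text \<open>\<open>point_of\<close> sees the angle only through its sine and cosine, so one period
  yields every point. The unrestricted angle matches the form of
  \<open>base_plane_eq\<close>.\<close>

lemma circle_pts_eq: "circle_pts r = {point_of (r, \<theta>, 0) | \<theta>. True}"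
proof -
  have "point_of (r, \<theta>, 0) \<in> circle_pts r" for \<theta>
  proof -
    obtain y where "- pi < y" "y \<le> pi" "sin y = sin \<theta>" "cos y = cos \<theta>"
      using sincos_principal_value[of \<theta>] by blast
    then show ?thesis
      unfolding circle_pts_def
      by (intro image_eqI[of _ _ y]) (auto simp: circle_curve_def point_of_def)
  qed
  then show ?thesis
    by (auto simp: circle_pts_def circle_curve_def)
qed

lemma circle_curve_has_vector_derivative:
  "(circle_curve r has_vector_derivative (0, 1, 0)) (at \<theta>)"
  unfolding circle_curve_def
  by (intro has_vector_derivative_Pair has_vector_derivative_const has_vector_derivative_id)

lemma perimeter_eq_integral:
  "perimeter r = integral {-pi..pi} (\<lambda>\<theta>. sqrt ((sinh r)\<^sup>2 * ((sinh r)\<^sup>2 + (cosh r)\<^sup>2)))"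
proof -
  \<comment> \<open>Although \<open>\<phi>\<close> is constant along the circle, the fibre term
    still contributes the fourth power of \<open>sinh r\<close>.\<close>
  have "metric_form (circle_curve r \<theta>) (0, 1, 0) = (sinh r)\<^sup>2 * ((sinh r)\<^sup>2 + (cosh r)\<^sup>2)" for \<theta>
    by (simp add: metric_form_def circle_curve_def power2_eq_square algebra_simps)
  then show ?thesis
    by (simp add: perimeter_def curve_length_def
        vector_derivative_at[OF circle_curve_has_vector_derivative])
qed

theorem lemma4p3:
  fixes r :: real
  assumes "r > 0"
  shows "circle_pts r = {P \<in> base_plane. geodesic_dist E0 P = r} \<and>
    perimeter r = integral {-pi..pi} (\<lambda>\<theta>. sqrt ((sinh r)\<^sup>2 * ((sinh r)\<^sup>2 + (cosh r)\<^sup>2))) \<and>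
    integral {-pi..pi} (\<lambda>\<theta>. sqrt ((sinh r)\<^sup>2 * ((sinh r)\<^sup>2 + (cosh r)\<^sup>2))) =
      2 * pi * sinh r * sqrt (cosh (2 * r))"
proof (intro conjI)
  \<comment> \<open>In the base plane the distance from the origin is the radial coordinate, so the
    sphere condition just fixes that coordinate to \<open>r\<close>.\<close>
  show "circle_pts r = {P \<in> base_plane. geodesic_dist E0 P = r}"
    using assms geodesic_dist_base_plane
    by (fastforce simp: circle_pts_eq base_plane_eq)
  show "perimeter r = integral {-pi..pi} (\<lambda>\<theta>. sqrt ((sinh r)\<^sup>2 * ((sinh r)\<^sup>2 + (cosh r)\<^sup>2)))"
    by (rule perimeter_eq_integral)
  have "(sinh r)\<^sup>2 + (cosh r)\<^sup>2 = cosh (2 * r)"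
    by (simp add: cosh_double)
  then show "integral {-pi..pi} (\<lambda>\<theta>. sqrt ((sinh r)\<^sup>2 * ((sinh r)\<^sup>2 + (cosh r)\<^sup>2))) =
      2 * pi * sinh r * sqrt (cosh (2 * r))"
    \<comment> \<open>Positivity of \<open>r\<close> gives \<open>sinh r > 0\<close>, so the root of
      its square is \<open>sinh r\<close> without an absolute value.\<close>
    using assms by (simp add: real_sqrt_mult)
qed

end
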